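(* Let $G$ be a finite simple connected graph with odd girth $2s+1$ (that is, $G$ contains an odd cycle and the shortest odd cycle of $G$ has length $2s+1$). Then the Cartesian product $G\square K_2$ is not DWR.
   Context: A connected graph is DWR (distance walk regular) if for any two vertices $u,v$ and any $k\in\mathbb{N}$, the existence of a walk of length $k$ between $u$ and $v$ depends only on $k$ and on $d(u,v)$. The Cartesian product $G\square H$ has vertex set $V(G)\times V(H)$, and $(g_1,h_1)\sim(g_2,h_2)$ iff ($g_1=g_2$ and $h_1\sim h_2$) or ($h_1=h_2$ and $g_1\sim g_2$). $K_2$ is the complete graph on two vertices. *)

theory Defs
  imports "Graph_Theory.Graph_Theory" "HOL-Library.Extended_Nat"
begin

text \<open>
  Finite simple graphs are represented as in Graph_Theory, by symmetric loop-free digraphs without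
  parallel arcs (\<^locale>\<open>pair_graph\<close>).
\<close>

definition box_prod :: "'a pair_pre_digraph \<Rightarrow> 'b pair_pre_digraph \<Rightarrow> ('a \<times> 'b) pair_pre_digraph"
    (infixl \<open>\<box>\<close> 70) where
  "G \<box> H = \<lparr> pverts = pverts G \<times> pverts H,
     parcs = {((g1, h1), (g2, h2)) | g1 h1 g2 h2.
       (g1 = g2 \<and> g1 \<in> pverts G \<and> (h1, h2) \<in> parcs H) \<or>
       (h1 = h2 \<and> h1 \<in> pverts H \<and> (g1, g2) \<in> parcs G)} \<rparr>"

definition walk_of_length :: "('a, 'b) pre_digraph \<Rightarrow> nat \<Rightarrow> 'a \<Rightarrow> 'a \<Rightarrow> bool" where
  "walk_of_length G k u v \<longleftrightarrow> (\<exists>p. pre_digraph.awalk G u p v \<and> length p = k)"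

text \<open>The graph distance: the cost of a shortest walk, where every arc has weight 1.\<close>

definition graph_dist :: "('a, 'b) pre_digraph \<Rightarrow> 'a \<Rightarrow> 'a \<Rightarrow> ereal" where
  "graph_dist G = wf_digraph.\<mu> G (\<lambda>_. 1)"

definition DWR :: "('a, 'b) pre_digraph \<Rightarrow> bool" where
  "DWR G \<longleftrightarrow> connected G \<and>
     (\<forall>u\<in>verts G. \<forall>v\<in>verts G. \<forall>u'\<in>verts G. \<forall>v'\<in>verts G. \<forall>k.
        graph_dist G u v = graph_dist G u' v' \<longrightarrow>
        (walk_of_length G k u v \<longleftrightarrow> walk_of_length G k u' v'))"

text \<open>
  The odd girth is \<open>\<infinity>\<close> if there is no odd cycle. The library's \<^const>\<open>pre_digraph.cycle\<close>
  also admits the closed walks of length 2 that run back and forth along an edge, but in a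
  loop-free graph every cycle of odd length has length at least 3 and is an ordinary cycle.
\<close>

definition odd_girth :: "('a, 'b) pre_digraph \<Rightarrow> enat" where
  "odd_girth G = (INF p \<in> {p. pre_digraph.cycle G p \<and> odd (length p)}. enat (length p))"

lemma box_prod_simps [simp]:
  "pverts (G \<box> H) = pverts G \<times> pverts H"
  "((g1, h1), (g2, h2)) \<in> parcs (G \<box> H) \<longleftrightarrow>
     (g1 = g2 \<and> g1 \<in> pverts G \<and> (h1, h2) \<in> parcs H) \<or>
     (h1 = h2 \<and> h1 \<in> pverts H \<and> (g1, g2) \<in> parcs G)"
  by (auto simp: box_prod_def)

lemma pair_graph_box_prod:
  assumes "pair_graph G" "pair_graph H"
  shows "pair_graph (G \<box> H)"
proof -
  interpret G: pair_graph G by fact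
  interpret H: pair_graph H by fact
  have sub: "parcs (G \<box> H) \<subseteq> (pverts G \<times> pverts H) \<times> (pverts G \<times> pverts H)"
    by (auto dest: G.in_arcsD1 G.in_arcsD2 H.in_arcsD1 H.in_arcsD2)
  moreover have "finite ((pverts G \<times> pverts H) \<times> (pverts G \<times> pverts H))"
    by (simp add: G.pair_finite_verts H.pair_finite_verts)
  ultimately have fin: "finite (parcs (G \<box> H))"
    by (rule finite_subset)
  have sym: "sym (parcs (G \<box> H))"
    by (rule symI) (auto intro: G.arcs_symmetric H.arcs_symmetric)
  show ?thesis
  proof
    show "fst e \<noteq> snd e" if "e \<in> parcs (G \<box> H)" for e
      using that by (cases e) (auto dest: G.no_loops' H.no_loops')
    show "symmetric (with_proj (G \<box> H))"
      using sym by (simp add: symmetric_def)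
  qed (use sub fin in \<open>auto simp: G.pair_finite_verts H.pair_finite_verts\<close>)
qed

lemma connected_box_prod:
  assumes "pair_graph G" "pair_graph H" "connected (with_proj G)" "connected (with_proj H)"
  shows "connected (with_proj (G \<box> H))"
proof -
  interpret G: pair_graph G by fact
  interpret H: pair_graph H by fact
  interpret GH: pair_graph "G \<box> H" using assms(1,2) by (rule pair_graph_box_prod)
  have left: "(g, h) \<rightarrow>\<^sup>*\<^bsub>with_proj (G \<box> H)\<^esub> (g', h)"
    if "g \<rightarrow>\<^sup>*\<^bsub>with_proj G\<^esub> g'" "h \<in> pverts H" for g g' h
    using that(1)
  proof (induction rule: G.reachable_induct)
    case base
    then show ?case using that(2) by simp
  next
    case (step x y)
    then have "(x, h) \<rightarrow>\<^bsub>with_proj (G \<box> H)\<^esub> (y, h)"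
      using that(2) by simp
    with step.IH show ?case by (rule wf_digraph.reachable_adj_trans[OF GH.wf_digraph_axioms])
  qed
  have right: "(g, h) \<rightarrow>\<^sup>*\<^bsub>with_proj (G \<box> H)\<^esub> (g, h')"
    if "h \<rightarrow>\<^sup>*\<^bsub>with_proj H\<^esub> h'" "g \<in> pverts G" for g h h'
    using that(1)
  proof (induction rule: H.reachable_induct)
    case base
    then show ?case using that(2) by simp
  next
    case (step x y)
    then have "(g, x) \<rightarrow>\<^bsub>with_proj (G \<box> H)\<^esub> (g, y)"
      using that(2) by simp
    with step.IH show ?case by (rule wf_digraph.reachable_adj_trans[OF GH.wf_digraph_axioms])
  qed
  have G: "strongly_connected (with_proj G)" and H: "strongly_connected (with_proj H)"
    using assms(3,4) G.symmetric_connected_imp_strongly_connected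
      H.symmetric_connected_imp_strongly_connected G.sym_arcs H.sym_arcs by blast+
  have "strongly_connected (with_proj (G \<box> H))"
    unfolding strongly_connected_def
  proof (intro conjI ballI)
    show "verts (with_proj (G \<box> H)) \<noteq> {}"
      using G H by (simp add: strongly_connected_def)
    fix u v assume "u \<in> verts (with_proj (G \<box> H))" "v \<in> verts (with_proj (G \<box> H))"
    then obtain g h g' h' where "u = (g, h)" "v = (g', h')"
      "g \<in> pverts G" "h \<in> pverts H" "g' \<in> pverts G" "h' \<in> pverts H"
      by auto
    moreover from this have "g \<rightarrow>\<^sup>*\<^bsub>with_proj G\<^esub> g'" "h \<rightarrow>\<^sup>*\<^bsub>with_proj H\<^esub> h'"
      using G H by (simp_all add: strongly_connected_def)
    ultimately show "u \<rightarrow>\<^sup>*\<^bsub>with_proj (G \<box> H)\<^esub> v"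
      using left right GH.reachable_trans by metis
  qed
  then show ?thesis by (simp add: connected_def strongly_connected_def
      wf_digraph.reachable_mk_symmetric_eq[OF GH.wf_digraph_axioms GH.sym_arcs])
qed

end

theory Submission
  imports Defs
begin

text \<open>
  Let \<open>2 * s + 1\<close> be the odd girth of \<open>G\<close> and cut a shortest odd cycle at three of its vertices:
  \<open>x\<close>, the vertex \<open>y\<close> reached from \<open>x\<close> after \<open>s\<close> steps, and the vertex \<open>z\<close> just before \<open>y\<close>.
  A shortest odd cycle has no shortcuts, so \<open>x\<close> and \<open>y\<close> are at distance \<open>s\<close>, and \<open>x\<close> and \<open>z\<close> at
  distance \<open>s - 1\<close>. Let \<open>a\<close> and \<open>b\<close> be the vertices of \<open>K\<^sub>2\<close>. The pairs \<open>(x, a), (y, a)\<close> and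
  \<open>(x, a), (z, b)\<close> are both at distance \<open>s\<close> in \<open>G \<box> K\<^sub>2\<close>, but only the first one is joined by a
  walk of length \<open>s + 1\<close>:

  \<^item> The other side of the cycle is a walk of length \<open>s + 1\<close> from \<open>y\<close> to \<open>x\<close>, and it can be
    reversed inside the layer of \<open>a\<close>.
  \<^item> A walk from \<open>(x, a)\<close> to \<open>(z, b)\<close> changes the layer an odd number of times. With three or more
    changes, fewer than \<open>s - 1\<close> of the \<open>s + 1\<close> steps are left for getting from \<open>x\<close> to \<open>z\<close>; with
    one change, the remaining \<open>s\<close> steps together with the \<open>s - 1\<close> steps back along the cycle form
    a closed walk of odd length \<open>2 * s - 1\<close>, which is below the odd girth.

  Two facts carry this. A closed walk of odd length contains an odd cycle, so the odd girth
  bounds the length of all odd closed walks (\<open>odd_girth_le_odd_closed_walk\<close>). And a walk in a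
  Cartesian product is an interleaving of a walk in each factor (\<open>walk_of_length_box_prod\<close>).
\<close>

section \<open>Walks of a given length\<close>

context wf_digraph
begin

lemma walk_of_length_0: "walk_of_length G 0 u v \<longleftrightarrow> u = v \<and> u \<in> verts G"
  by (simp add: walk_of_length_def awalk_Nil_iff)

lemma walk_of_length_Suc:
  "walk_of_length G (Suc k) u v \<longleftrightarrow> (\<exists>w. (u, w) \<in> arcs_ends G \<and> walk_of_length G k w v)"
proof
  assume "walk_of_length G (Suc k) u v"
  then obtain e p where "awalk u (e # p) v" "length p = k"
    by (auto simp: walk_of_length_def length_Suc_conv)
  then show "\<exists>w. (u, w) \<in> arcs_ends G \<and> walk_of_length G k w v"
    by (auto simp: awalk_Cons_iff walk_of_length_def intro: in_arcs_imp_in_arcs_ends)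
next
  assume "\<exists>w. (u, w) \<in> arcs_ends G \<and> walk_of_length G k w v"
  then obtain e p where "e \<in> arcs G" "tail G e = u" "awalk (head G e) p v" "length p = k"
    by (auto simp: walk_of_length_def arcs_ends_conv)
  then have "awalk u (e # p) v" "length (e # p) = Suc k"
    by (simp_all add: awalk_Cons_iff)
  then show "walk_of_length G (Suc k) u v"
    unfolding walk_of_length_def by blast
qed

lemma walk_of_length_in_verts:
  assumes "walk_of_length G k u v"
  shows "u \<in> verts G" "v \<in> verts G"
  using assms by (auto simp: walk_of_length_def dest: awalk_hd_in_verts awalk_last_in_verts)

lemma walk_of_length_1: "walk_of_length G (Suc 0) u v \<longleftrightarrow> (u, v) \<in> arcs_ends G"
  by (auto simp: walk_of_length_Suc walk_of_length_0 dest: adj_in_verts)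

lemma walk_of_length_add:
  "walk_of_length G (m + n) u v \<longleftrightarrow>
    (\<exists>w. walk_of_length G m u w \<and> walk_of_length G n w v)"
proof (induction m arbitrary: u)
  case 0
  then show ?case by (auto simp: walk_of_length_0 intro: walk_of_length_in_verts)
next
  case (Suc m)
  then show ?case by (auto simp: walk_of_length_Suc)
qed

lemma walk_of_length_trans:
  assumes "walk_of_length G m u w" "walk_of_length G n w v"
  shows "walk_of_length G (m + n) u v"
  using assms by (auto simp: walk_of_length_add)

lemma walk_of_length_sym:
  assumes "symmetric G" "walk_of_length G k u v"
  shows "walk_of_length G k v u"
  using assms(2)
proof (induction k arbitrary: u)
  case 0
  then show ?case by (auto simp: walk_of_length_0)
next
  case (Suc k)
  then obtain w where w: "(u, w) \<in> arcs_ends G" "walk_of_length G k w v"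
    by (auto simp: walk_of_length_Suc)
  have "walk_of_length G (Suc 0) w u"
    using w(1) assms(1) by (simp add: walk_of_length_1 symmetric_def symD)
  with Suc.IH[OF w(2)] have "walk_of_length G (k + Suc 0) v u"
    by (rule walk_of_length_trans)
  then show ?case by simp
qed

lemma graph_dist_eqI:
  assumes "walk_of_length G n u v"
    and "\<And>k. walk_of_length G k u v \<Longrightarrow> n \<le> k"
  shows "graph_dist G u v = ereal (real n)"
proof -
  have cost: "awalk_cost (\<lambda>_. 1) p = real (length p)" for p :: "'b list"
    by (induction p) auto
  obtain p where p: "awalk u p v" "length p = n"
    using assms(1) by (auto simp: walk_of_length_def)
  show ?thesis
    unfolding graph_dist_def \<mu>_def cost
  proof (rule antisym)
    show "(INF p\<in>{p. awalk u p v}. ereal (real (length p))) \<le> ereal (real n)"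
      using p by (auto intro: INF_lower2)
    show "ereal (real n) \<le> (INF p\<in>{p. awalk u p v}. ereal (real (length p)))"
      using assms(2) by (force intro!: INF_greatest simp: walk_of_length_def)
  qed
qed

section \<open>Odd closed walks and the odd girth\<close>

text \<open>
  If a closed walk is not a cycle, a closed subwalk can be cut out of it. The lengths of the
  subwalk and of the rest add up to the length of the walk, so one of the two is again an odd
  closed walk, and it is shorter.
\<close>

lemma odd_closed_walk_contains_odd_cycle:
  assumes "awalk u p u" "odd (length p)"
  shows "\<exists>c. cycle c \<and> odd (length c) \<and> length c \<le> length p"
  using assms
proof (induction "length p" arbitrary: u p rule: less_induct)
  case less
  then obtain e es where p: "p = e # es"
    by (cases p) auto
  show ?case
  proof (cases "distinct (tl (awalk_verts u p))")
    case True
    then have "cycle p"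
      using less.prems p unfolding cycle_def by blast
    then show ?thesis using less.prems(2) by blast
  next
    case False
    have es: "e \<in> arcs G" "u = tail G e" "awalk (head G e) es u"
      using less.prems(1) by (auto simp: p awalk_Cons_iff)
    with False obtain q r s w where dec: "es = q @ r @ s" "awalk (head G e) q w"
        "awalk w r w" "awalk w s u" "closed_w r"
      by (auto simp: p elim!: awalk_cyc_decompE'[OF es(3)])
    have "r \<noteq> []"
      using dec(5) by (auto simp: closed_w_def)
    show ?thesis
    proof (cases "odd (length r)")
      case True
      have "length r < length p"
        using p dec(1) by simp
      from less.hyps[OF this dec(3) True] this show ?thesis
        by (meson less_imp_le order_trans)
    next
      case even: False
      have "awalk u (e # q @ s) u"
        using es dec by (simp add: awalk_Cons_iff awalk_appendI)
      moreover have "length (e # q @ s) < length p"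
        using p dec(1) \<open>r \<noteq> []\<close> by simp
      moreover have "odd (length (e # q @ s))"
        using less.prems(2) p dec(1) even by simp
      ultimately show ?thesis
        using less.hyps by (meson less_imp_le order_trans)
    qed
  qed
qed

lemma odd_girth_le_odd_closed_walk:
  assumes "walk_of_length G k u u" "odd k"
  shows "odd_girth G \<le> enat k"
proof -
  obtain c where "cycle c" "odd (length c)" "length c \<le> k"
    using assms odd_closed_walk_contains_odd_cycle by (auto simp: walk_of_length_def)
  then show ?thesis
    unfolding odd_girth_def by (auto intro: INF_lower2)
qed

lemma odd_girth_attained:
  assumes "odd_girth G = enat g"
  shows "\<exists>u. walk_of_length G g u u"
proof -
  let ?L = "(\<lambda>p. enat (length p)) ` {p. cycle p \<and> odd (length p)}"
  have "?L \<noteq> {}"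
  proof
    assume "?L = {}"
    then have "odd_girth G = \<infinity>"
      unfolding odd_girth_def by (simp only: Inf_enat_def) simp
    with assms show False by simp
  qed
  then have "Inf ?L \<in> ?L"
    by (meson all_not_in_conv wellorder_InfI)
  then obtain p where "cycle p" "length p = g"
    using assms unfolding odd_girth_def by auto
  then show ?thesis
    by (auto simp: cycle_def walk_of_length_def)
qed

end

section \<open>Walks in Cartesian products\<close>

text \<open>
  Each step of a walk in the product moves in exactly one of the factors. Conversely, walks in
  the factors are combined by first following the one in \<open>G\<close> and then the one in \<open>H\<close>.
\<close>

lemma walk_of_length_box_prod:
  assumes "pair_graph G" "pair_graph H"
  shows "walk_of_length (with_proj (G \<box> H)) k (x, i) (y, j) \<longleftrightarrow>
    (\<exists>l m. k = l + m \<and> walk_of_length (with_proj G) l x y \<and> walk_of_length (with_proj H) m i j)"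
    (is "?L \<longleftrightarrow> ?R")
proof -
  interpret G: pair_graph G by fact
  interpret H: pair_graph H by fact
  interpret GH: pair_graph "G \<box> H" using assms by (rule pair_graph_box_prod)
  show ?thesis
  proof
    show "?L \<Longrightarrow> ?R"
    proof (induction k arbitrary: x i)
      case 0
      then show ?case by (auto simp: GH.walk_of_length_0 G.walk_of_length_0 H.walk_of_length_0)
    next
      case (Suc k)
      then obtain x' i' where step: "((x, i), (x', i')) \<in> parcs (G \<box> H)"
        and "walk_of_length (with_proj (G \<box> H)) k (x', i') (y, j)"
        by (auto simp: GH.walk_of_length_Suc)
      with Suc.IH obtain l m where lm: "k = l + m"
          "walk_of_length (with_proj G) l x' y" "walk_of_length (with_proj H) m i' j"
        by blast
      from step consider "x = x'" "(i, i') \<in> parcs H" | "i = i'" "(x, x') \<in> parcs G"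
        by auto
      then show ?case
      proof cases
        case 1
        with lm have "walk_of_length (with_proj G) l x y" "walk_of_length (with_proj H) (Suc m) i j"
          by (auto simp: H.walk_of_length_Suc)
        then show ?thesis using lm(1) by (metis add_Suc_right)
      next
        case 2
        with lm have "walk_of_length (with_proj G) (Suc l) x y" "walk_of_length (with_proj H) m i j"
          by (auto simp: G.walk_of_length_Suc)
        then show ?thesis using lm(1) by (metis add_Suc)
      qed
    qed
  next
    have left: "walk_of_length (with_proj (G \<box> H)) l (x, i) (y, i)"
      if "walk_of_length (with_proj G) l x y" "i \<in> pverts H" for l
      using that
      by (induction l arbitrary: x)
        (force simp: GH.walk_of_length_0 G.walk_of_length_0
          GH.walk_of_length_Suc G.walk_of_length_Suc)+
    have right: "walk_of_length (with_proj (G \<box> H)) m (y, i) (y, j)"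
      if "walk_of_length (with_proj H) m i j" "y \<in> pverts G" for m
      using that
      by (induction m arbitrary: i)
        (force simp: GH.walk_of_length_0 H.walk_of_length_0
          GH.walk_of_length_Suc H.walk_of_length_Suc)+
    assume ?R
    then obtain l m where lm: "k = l + m"
        "walk_of_length (with_proj G) l x y" "walk_of_length (with_proj H) m i j"
      by blast
    have "y \<in> pverts G" "i \<in> pverts H"
      using G.walk_of_length_in_verts(2)[OF lm(2)] H.walk_of_length_in_verts(1)[OF lm(3)]
      by simp_all
    with lm show ?L
      using GH.walk_of_length_trans[OF left right] by simp
  qed
qed

text \<open>A walk in \<open>K\<^sub>2\<close> has no choice but to alternate between the two vertices.\<close>

lemma walk_of_length_K2:
  assumes "pair_graph H" "pverts H = {a, b}" "a \<noteq> b" "parcs H = {(a, b), (b, a)}"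
  shows "walk_of_length (with_proj H) m i j \<longleftrightarrow> i \<in> {a, b} \<and> j \<in> {a, b} \<and> (even m \<longleftrightarrow> i = j)"
proof -
  interpret H: pair_graph H by fact
  show ?thesis
    using assms(2-4)
    by (induction m arbitrary: i) (auto simp: H.walk_of_length_0 H.walk_of_length_Suc)
qed

section \<open>The product with an edge\<close>

theorem theorem5p7:
  fixes G :: "'a pair_pre_digraph" and K2 :: "'b pair_pre_digraph" and s :: nat
  assumes "pair_graph G"
    and "connected (with_proj G)"
    and "odd_girth (with_proj G) = enat (2 * s + 1)"
    and "complete_digraph 2 (with_proj K2)"
  shows "\<not> DWR (with_proj (G \<box> K2))"
proof
  assume dwr: "DWR (with_proj (G \<box> K2))"
  have K2: "pair_graph K2"
    using assms(4) by (rule pair_graphI_complete)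
  interpret G: pair_graph G by fact
  interpret P: pair_graph "G \<box> K2"
    using assms(1) K2 by (rule pair_graph_box_prod)
  have "card (pverts K2) = 2"
      and parcs: "parcs K2 = {(u, v). (u, v) \<in> pverts K2 \<times> pverts K2 \<and> u \<noteq> v}"
    using assms(4) by (simp_all add: complete_digraph_pair_def)
  then obtain a b where ab: "pverts K2 = {a, b}" "a \<noteq> b"
    by (auto simp: card_2_iff)
  with parcs have "parcs K2 = {(a, b), (b, a)}"
    by auto
  note walk_K2 = walk_of_length_K2[OF K2 ab this]
  note walk_P = walk_of_length_box_prod[OF assms(1) K2] walk_K2
  let ?W = "walk_of_length (with_proj G)"
  let ?P = "walk_of_length (with_proj (G \<box> K2))"
  have girth: "2 * s + 1 \<le> k" if "?W k u u" "odd k" for k u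
    using G.odd_girth_le_odd_closed_walk[OF that] assms(3) by simp
  obtain x where closed: "?W (2 * s + 1) x x"
    using G.odd_girth_attained[OF assms(3)] by blast
  have "s \<noteq> 0"
    using closed G.no_loops' by (cases "s = 0") (auto simp: G.walk_of_length_1)
  then obtain t where t: "s = Suc t"
    by (cases s) auto
  have "?W (t + (Suc 0 + Suc s)) x x"
    using closed by (simp add: t mult_2)
  then obtain y z where xz: "?W t x z" and zy: "?W (Suc 0) z y" and yx: "?W (Suc s) y x"
    unfolding G.walk_of_length_add by blast
  have xy: "?W s x y"
    using G.walk_of_length_trans[OF xz zy] by (simp add: t)
  have xy': "?W (Suc s) x y" and yx': "?W s y x" and zx: "?W t z x"
    using yx xy xz by (auto intro: G.walk_of_length_sym)

  \<comment> \<open>A shortcut can be closed up along either side of the cycle, and the two sides have lengths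
      of different parity.\<close>
  have dist_xy: "s \<le> l" if l: "?W l x y" for l
  proof (rule ccontr)
    assume "\<not> s \<le> l"
    then show False
      using girth[OF G.walk_of_length_trans[OF l yx']] girth[OF G.walk_of_length_trans[OF l yx]]
      by (cases "odd (l + s)") auto
  qed
  have dist_xz: "t \<le> l" if "?W l x z" for l
    using dist_xy[OF G.walk_of_length_trans[OF that zy]] by (simp add: t)

  have "graph_dist (with_proj (G \<box> K2)) (x, a) (y, a) = ereal (real s)"
  proof (rule P.graph_dist_eqI)
    show "?P s (x, a) (y, a)"
      using xy by (force simp: walk_P)
    show "s \<le> k" if "?P k (x, a) (y, a)" for k
      using that by (auto simp: walk_P dest!: dist_xy)
  qed
  moreover have "graph_dist (with_proj (G \<box> K2)) (x, a) (z, b) = ereal (real s)"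
  proof (rule P.graph_dist_eqI)
    have "?W t x z \<and> walk_of_length (with_proj K2) 1 a b"
      using xz ab(2) by (simp add: walk_K2)
    then show "?P s (x, a) (z, b)"
      unfolding walk_of_length_box_prod[OF assms(1) K2] t by (metis Suc_eq_plus1)
    show "s \<le> k" if "?P k (x, a) (z, b)" for k
    proof -
      obtain l m where "k = l + m" "?W l x z" "odd m"
        using \<open>?P k (x, a) (z, b)\<close> ab(2) by (auto simp: walk_P)
      with dist_xz[of l] odd_pos[of m] show ?thesis
        by (simp add: t)
    qed
  qed
  moreover have "?P (Suc s) (x, a) (y, a)"
    using xy' by (force simp: walk_P)
  moreover have "\<not> ?P (Suc s) (x, a) (z, b)"
  proof
    assume "?P (Suc s) (x, a) (z, b)"
    then obtain l m where lm: "Suc s = l + m" "?W l x z" "odd m"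
      using ab(2) by (auto simp: walk_P)
    have "m \<le> 2"
      using dist_xz[OF lm(2)] lm(1) by (simp add: t)
    with lm(3) have "m = 1"
      by (cases "m = 2") (auto simp: le_Suc_eq numeral_2_eq_2)
    with lm have "l = s"
      by simp
    then have "?W (s + t) x x"
      using G.walk_of_length_trans[OF lm(2) zx] by simp
    then show False
      using girth[of "s + t" x] by (simp add: t)
  qed
  moreover have "x \<in> pverts G" "y \<in> pverts G" "z \<in> pverts G"
    using G.walk_of_length_in_verts[OF xy] G.walk_of_length_in_verts[OF xz] by simp_all
  ultimately show False
    using dwr ab(1) unfolding DWR_def
    by (metis SigmaI box_prod_simps(1) insertI1 insertI2 with_proj_simps(1))
qed

end
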